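(* Let $n\ge 1$, $1\le k\le n$, and let $(P_1,\dots,P_n)$ be a random vector (of $p$-values, taking values in $[0,1]$) having an $\mathrm{MTP}_2$ distribution. Let $0<\alpha_k\le\cdots\le\alpha_n<1$ be fixed constants and let $a_i=\binom{i}{k}$ for $i=k,\dots,n$. Let $\mathcal{C}_k$ be the collection of subsets of $\{1,\dots,n\}$ of size $k$ and, for $J\in\mathcal{C}_k$, let $P_{k:J}=\max_{j\in J}P_j$. If, for every $J\in\mathcal{C}_k$, the quantity $a_i^{-1}\Pr(P_{k:J}\le\alpha_i)$ is nondecreasing in $i=k,\dots,n$, then $$\Pr\left\{\bigcup_{i=k}^{n}(P_{i:n}\le\alpha_i)\right\}\le a_n^{-1}\sum_{J\in\mathcal{C}_k}\Pr\{P_{k:J}\le\alpha_n\},$$ where $P_{1:n}\le\cdots\le P_{n:n}$ are the ordered values of $P_1,\dots,P_n$.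
   Context: $\mathrm{MTP}_2$ (multivariate totally positive of order two): for $\mathbf{x},\mathbf{y}$ in a product $\mathcal{X}=\prod_{i=1}^n\mathcal{X}_i$ of totally ordered spaces, $\mathbf{x}\vee\mathbf{y}$ and $\mathbf{x}\wedge\mathbf{y}$ denote the coordinatewise maximum and minimum. A function $f:\mathcal{X}\to[0,\infty)$ is $\mathrm{MTP}_2$ if $f(\mathbf{x}\vee\mathbf{y})f(\mathbf{x}\wedge\mathbf{y})\ge f(\mathbf{x})f(\mathbf{y})$ for all $\mathbf{x},\mathbf{y}\in\mathcal{X}$. A random vector (or its distribution) is $\mathrm{MTP}_2$ if it has a density, with respect to a product of $\sigma$-finite measures on the coordinates, that is $\mathrm{MTP}_2$. *)

theory Defs
  imports "HOL-Probability.Probability"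
begin

definition MTP2_on :: "'i set \<Rightarrow> ('i \<Rightarrow> 'b::linorder set) \<Rightarrow> (('i \<Rightarrow> 'b) \<Rightarrow> real) \<Rightarrow> bool" where
  "MTP2_on I X f \<longleftrightarrow>
     (\<forall>x \<in> Pi\<^sub>E I X. 0 \<le> f x) \<and>
     (\<forall>x \<in> Pi\<^sub>E I X. \<forall>y \<in> Pi\<^sub>E I X.
        f x * f y \<le> f (\<lambda>i\<in>I. max (x i) (y i)) * f (\<lambda>i\<in>I. min (x i) (y i)))"

text \<open>
  The coordinate spaces are taken to be the whole real line. For a vector with values in a
  product of Borel subsets of the line this is no restriction: a density on the smaller product
  extends by zero, and a density on the full product restricts, preserving the inequality.
\<close>

definition MTP2_vector :: "'a measure \<Rightarrow> 'i set \<Rightarrow> ('i \<Rightarrow> 'a \<Rightarrow> real) \<Rightarrow> bool" where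
  "MTP2_vector M I P \<longleftrightarrow>
     (\<exists>\<nu> f. (\<forall>i\<in>I. sigma_finite_measure (\<nu> i) \<and> sets (\<nu> i) = sets borel) \<and>
            MTP2_on I (\<lambda>_. UNIV) f \<and>
            distributed M (Pi\<^sub>M I \<nu>) (\<lambda>\<omega>. \<lambda>i\<in>I. P i \<omega>) (\<lambda>x. ennreal (f x)))"

text \<open>The ordered values of \<open>x 1, \<dots>, x n\<close>, themselves numbered from 1 to \<open>n\<close>.\<close>

definition order_stat :: "nat \<Rightarrow> (nat \<Rightarrow> 'b::linorder) \<Rightarrow> nat \<Rightarrow> 'b" where
  "order_stat n x i = sort (map x [1..<Suc n]) ! (i - 1)"

end

theory Submission
  imports Defs
begin

text \<open>
  Let \<open>R\<close> be the largest \<open>i\<close> for which at least \<open>i\<close> of the \<open>P j\<close> are at most \<open>\<alpha> i\<close>. On \<open>R = i\<close> at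
  least \<open>i choose k\<close> of the sets \<open>J\<close> satisfy \<open>P\<^bsub>k:J\<^esub> \<le> \<alpha> i\<close>, so that
  \<open>Pr (R = i) \<le> (\<Sum>J. Pr (R = i, P\<^bsub>k:J\<^esub> \<le> \<alpha> i)) / a i\<close>. For a fixed \<open>J\<close> the events \<open>R \<le> i\<close> are
  upward closed in \<open>P\<close>, and by the four functions inequality their conditional probability given
  \<open>P\<^bsub>k:J\<^esub> \<le> t\<close> is nondecreasing in \<open>t\<close>. Hence the sum over \<open>i\<close> telescopes to at most
  \<open>Pr (P\<^bsub>k:J\<^esub> \<le> \<alpha> n) / a n\<close>.
\<close>

section \<open>The four functions inequality for product measures\<close>

text \<open>Expanding (c - a)(c - b) \<ge> 0 gives c(a + b) \<le> c^2 + ab \<le> c(c + d), and c > 0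
  cancels. If c = 0, then a = b = 0; if c or d is infinite, so is the right-hand side. This is the
  scalar core of the one-dimensional four functions inequality.\<close>

lemma ennreal_add_le_add_of_mult_le:
  fixes a b c d :: ennreal
  assumes "a \<le> c" "b \<le> c" "a * b \<le> c * d"
  shows "a + b \<le> c + d"
proof (cases "c = \<top> \<or> d = \<top>")
  case True
  then show ?thesis by auto
next
  case False
  then have "c < \<top>" "d < \<top>" "a < \<top>" "b < \<top>"
    using assms by (auto simp: less_top top_unique)
  then obtain a' b' c' d' where eq: "a = ennreal a'" "b = ennreal b'" "c = ennreal c'" "d = ennreal d'"
    and nn: "0 \<le> a'" "0 \<le> b'" "0 \<le> c'" "0 \<le> d'"
    by (metis enn2real_nonneg ennreal_enn2real)
  have le: "a' \<le> c'" "b' \<le> c'" "a' * b' \<le> c' * d'"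
    using assms nn by (auto simp: eq ennreal_mult[symmetric])
  have "a' + b' \<le> c' + d'"
  proof (cases "c' = 0")
    case True
    with le nn show ?thesis by simp
  next
    case False
    have "0 \<le> (c' - a') * (c' - b')"
      using le by simp
    then have "c' * (a' + b') \<le> c' * (c' + d')"
      using le(3) by (simp add: algebra_simps)
    with False nn(3) show ?thesis by simp
  qed
  then show ?thesis
    using nn by (simp add: eq ennreal_plus[symmetric] del: ennreal_plus)
qed

text \<open>
  The integrand of the double integral is symmetrised: the inequality then holds pointwise, and no
  splitting into \<open>x < y\<close>, \<open>x = y\<close> and \<open>x > y\<close> is needed.
\<close>

lemma four_functions_nn_integral:
  fixes f1 f2 f3 f4 :: "'b::linorder \<Rightarrow> ennreal"
  assumes [measurable]: "f1 \<in> borel_measurable M" "f2 \<in> borel_measurable M"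
    "f3 \<in> borel_measurable M" "f4 \<in> borel_measurable M"
    and le: "\<And>x y. x \<in> space M \<Longrightarrow> y \<in> space M \<Longrightarrow> f1 x * f2 y \<le> f3 (max x y) * f4 (min x y)"
  shows "integral\<^sup>N M f1 * integral\<^sup>N M f2 \<le> integral\<^sup>N M f3 * integral\<^sup>N M f4"
proof -
  have sym: "(\<integral>\<^sup>+x. (\<integral>\<^sup>+y. g x * h y + g y * h x \<partial>M) \<partial>M) = 2 * (integral\<^sup>N M g * integral\<^sup>N M h)"
    if [measurable]: "g \<in> borel_measurable M" "h \<in> borel_measurable M" for g h :: "'b \<Rightarrow> ennreal"
    by (simp add: nn_integral_add nn_integral_cmult nn_integral_multc mult_2)
  have ordered: "f1 x * f2 y + f1 y * f2 x \<le> f3 x * f4 y + f3 y * f4 x"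
    if "x \<in> space M" "y \<in> space M" "x \<le> y" for x y
  proof -
    \<comment> \<open>The scalar lemma is applied with c = \<open>f3 y * f4 x\<close> and d =
      \<open>f3 x * f4 y\<close>. The pairs (x, y) and (y, x) bound each summand by c; multiplying
      the diagonal cases (x, x) and (y, y) gives the bound of the product by cd.\<close>
    have "(f1 x * f2 x) * (f1 y * f2 y) \<le> (f3 x * f4 x) * (f3 y * f4 y)"
      using mult_mono[OF le[of x x] le[of y y]] that by simp
    moreover have "max x y = y" "min x y = x" "max y x = y" "min y x = x"
      using that by auto
    ultimately have "f1 x * f2 y + f1 y * f2 x \<le> f3 y * f4 x + f3 x * f4 y"
      using le[of x y] le[of y x] that
      by (intro ennreal_add_le_add_of_mult_le) (auto simp: ac_simps)
    then show ?thesis by (simp add: add.commute)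
  qed
  have "f1 x * f2 y + f1 y * f2 x \<le> f3 x * f4 y + f3 y * f4 x"
    if "x \<in> space M" "y \<in> space M" for x y
    using ordered[of x y] ordered[of y x] that linear[of x y] by (auto simp: add.commute)
  then have "2 * (integral\<^sup>N M f1 * integral\<^sup>N M f2) \<le> 2 * (integral\<^sup>N M f3 * integral\<^sup>N M f4)"
    unfolding sym[OF assms(1,2), symmetric] sym[OF assms(3,4), symmetric]
    by (intro nn_integral_mono) auto
  then show ?thesis
    by (simp add: ennreal_mult_le_mult_iff)
qed

text \<open>Induction on the index set. Integrating out the new coordinate while the others are
  fixed gives four functions on the smaller product; the one-dimensional inequality, applied to the
  sections at x, y, their join and their meet, shows that these satisfy the hypothesis
  again.\<close>

lemma four_functions_PiM:
  fixes M :: "'i \<Rightarrow> 'b::linorder measure" and f1 f2 f3 f4 :: "('i \<Rightarrow> 'b) \<Rightarrow> ennreal"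
  assumes "product_sigma_finite M" and "finite I"
    and "f1 \<in> borel_measurable (Pi\<^sub>M I M)" "f2 \<in> borel_measurable (Pi\<^sub>M I M)"
    "f3 \<in> borel_measurable (Pi\<^sub>M I M)" "f4 \<in> borel_measurable (Pi\<^sub>M I M)"
    and "\<And>x y. x \<in> space (Pi\<^sub>M I M) \<Longrightarrow> y \<in> space (Pi\<^sub>M I M) \<Longrightarrow>
      f1 x * f2 y \<le> f3 (\<lambda>i\<in>I. max (x i) (y i)) * f4 (\<lambda>i\<in>I. min (x i) (y i))"
  shows "integral\<^sup>N (Pi\<^sub>M I M) f1 * integral\<^sup>N (Pi\<^sub>M I M) f2
    \<le> integral\<^sup>N (Pi\<^sub>M I M) f3 * integral\<^sup>N (Pi\<^sub>M I M) f4"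
  using assms(2-)
proof (induction I arbitrary: f1 f2 f3 f4)
  case empty
  interpret product_sigma_finite M by fact
  \<comment> \<open>The empty product is the single point \<open>\<lambda>_. undefined\<close>,
    which is its own join and meet.\<close>
  have "f1 (\<lambda>_. undefined) * f2 (\<lambda>_. undefined) \<le> f3 (\<lambda>_. undefined) * f4 (\<lambda>_. undefined)"
    using empty.prems(5)[of "\<lambda>_. undefined" "\<lambda>_. undefined"] by (simp add: space_PiM restrict_def)
  then show ?case
    by (simp add: nn_integral_empty)
next
  case (insert i I)
  note [measurable] = insert.prems(1-4)
  interpret product_sigma_finite M by fact
  have upd: "x(i := s) \<in> space (Pi\<^sub>M (insert i I) M)"
    if "x \<in> space (Pi\<^sub>M I M)" "s \<in> space (M i)" for x s
    using that by (auto simp: space_PiM PiE_iff extensional_def)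
  have comb: "(\<lambda>j\<in>insert i I. h ((x(i := s)) j) ((y(i := t)) j)) = (\<lambda>j\<in>I. h (x j) (y j))(i := h s t)"
    for h :: "'b \<Rightarrow> 'b \<Rightarrow> 'b" and x y s t
    using insert.hyps by (auto simp: fun_eq_iff)
  have meas: "(\<lambda>s. g (x(i := s))) \<in> borel_measurable (M i)"
    if [measurable]: "g \<in> borel_measurable (Pi\<^sub>M (insert i I) M)" and "x \<in> space (Pi\<^sub>M I M)"
    for g :: "_ \<Rightarrow> ennreal" and x
    using measurable_compose[OF measurable_component_update[OF that(2) insert.hyps(2)] that(1)] .
  have "(\<integral>\<^sup>+x. (\<integral>\<^sup>+s. f1 (x(i := s)) \<partial>M i) \<partial>Pi\<^sub>M I M) * (\<integral>\<^sup>+x. (\<integral>\<^sup>+s. f2 (x(i := s)) \<partial>M i) \<partial>Pi\<^sub>M I M)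
    \<le> (\<integral>\<^sup>+x. (\<integral>\<^sup>+s. f3 (x(i := s)) \<partial>M i) \<partial>Pi\<^sub>M I M) * (\<integral>\<^sup>+x. (\<integral>\<^sup>+s. f4 (x(i := s)) \<partial>M i) \<partial>Pi\<^sub>M I M)"
  proof (rule insert.IH)
    fix x y assume x: "x \<in> space (Pi\<^sub>M I M)" and y: "y \<in> space (Pi\<^sub>M I M)"
    have "(\<lambda>j\<in>I. max (x j) (y j)) \<in> space (Pi\<^sub>M I M)" "(\<lambda>j\<in>I. min (x j) (y j)) \<in> space (Pi\<^sub>M I M)"
      using x y by (auto simp: space_PiM PiE_iff max_def min_def)
    moreover have "f1 (x(i := s)) * f2 (y(i := t))
        \<le> f3 ((\<lambda>j\<in>I. max (x j) (y j))(i := max s t)) * f4 ((\<lambda>j\<in>I. min (x j) (y j))(i := min s t))"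
      if "s \<in> space (M i)" "t \<in> space (M i)" for s t
      using insert.prems(5)[OF upd[OF x that(1)] upd[OF y that(2)]] unfolding comb .
    ultimately show "(\<integral>\<^sup>+s. f1 (x(i := s)) \<partial>M i) * (\<integral>\<^sup>+s. f2 (y(i := s)) \<partial>M i)
      \<le> (\<integral>\<^sup>+s. f3 ((\<lambda>j\<in>I. max (x j) (y j))(i := s)) \<partial>M i) * (\<integral>\<^sup>+s. f4 ((\<lambda>j\<in>I. min (x j) (y j))(i := s)) \<partial>M i)"
      using x y insert.prems(1-4) by (intro four_functions_nn_integral meas)
  qed measurable
  then show ?case
    using insert.hyps by (simp add: product_nn_integral_insert)
qed

section \<open>Conditional monotonicity under an MTP2 density\<close>

text \<open>The conditional probability of an upward closed event, given that all \<open>P j\<close>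
  with j in J are at most a level, increases with the level. Cross-multiplication keeps this
  meaningful when the conditioning event is null. The four functions are the density cut off to
  \<open>U \<inter> B s\<close>, \<open>B t\<close>, \<open>U \<inter> B t\<close> and
  \<open>B s\<close>: the join of x and y lies above x, hence in U, and in \<open>B t\<close>
  because s \<le> t; the meet lies below x, hence in \<open>B s\<close>.\<close>

lemma MTP2_vector_orthant_mono:
  fixes P :: "'i \<Rightarrow> 'a \<Rightarrow> real"
  assumes "prob_space M" "finite I" "MTP2_vector M I P" "J \<subseteq> I" "s \<le> t"
    and U: "U \<in> sets (Pi\<^sub>M I (\<lambda>_. borel))"
    and up: "\<And>x y. x \<in> U \<Longrightarrow> y \<in> extensional I \<Longrightarrow> (\<And>i. i \<in> I \<Longrightarrow> x i \<le> y i) \<Longrightarrow> y \<in> U"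
  shows "measure M {\<omega> \<in> space M. (\<lambda>i\<in>I. P i \<omega>) \<in> U \<and> (\<forall>j\<in>J. P j \<omega> \<le> s)}
      * measure M {\<omega> \<in> space M. \<forall>j\<in>J. P j \<omega> \<le> t}
    \<le> measure M {\<omega> \<in> space M. (\<lambda>i\<in>I. P i \<omega>) \<in> U \<and> (\<forall>j\<in>J. P j \<omega> \<le> t)}
      * measure M {\<omega> \<in> space M. \<forall>j\<in>J. P j \<omega> \<le> s}"
proof -
  interpret prob_space M by fact
  obtain \<nu> f where \<nu>: "\<And>i. i \<in> I \<Longrightarrow> sigma_finite_measure (\<nu> i)" "\<And>i. i \<in> I \<Longrightarrow> sets (\<nu> i) = sets borel"
    and mtp: "MTP2_on I (\<lambda>_. UNIV) f"
    and dist: "distributed M (Pi\<^sub>M I \<nu>) (\<lambda>\<omega>. \<lambda>i\<in>I. P i \<omega>) (\<lambda>x. ennreal (f x))"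
    using \<open>MTP2_vector M I P\<close> unfolding MTP2_vector_def by auto
  \<comment> \<open>\<open>\<nu>\<close> is controlled on I only, whereas
    \<open>product_sigma_finite\<close> asks for a sigma-finite measure at every index; Lebesgue
    measure fills the gap.\<close>
  define N where "N i = (if i \<in> I then \<nu> i else lborel)" for i
  have "sigma_finite_measure (N i)" for i
    by (simp add: N_def \<nu>(1) sigma_finite_lborel)
  then have N: "product_sigma_finite N"
    by (simp add: product_sigma_finite_def)
  have "Pi\<^sub>M I N = Pi\<^sub>M I \<nu>"
    by (rule PiM_cong) (auto simp: N_def)
  then have D: "distributed M (Pi\<^sub>M I N) (\<lambda>\<omega>. \<lambda>i\<in>I. P i \<omega>) (\<lambda>x. ennreal (f x))"
    using dist by simp
  have sets_N: "sets (Pi\<^sub>M I N) = sets (Pi\<^sub>M I (\<lambda>_. borel))"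
    using \<nu>(2) by (intro sets_PiM_cong) (auto simp: N_def)
  have space_N: "space (Pi\<^sub>M I N) = extensional I"
    using sets_eq_imp_space_eq[OF sets_N] by (simp add: space_PiM PiE_def)
  have ext: "z \<in> Pi\<^sub>E I (\<lambda>_. UNIV)" if "z \<in> extensional I" for z :: "'i \<Rightarrow> real"
    using that by (simp add: PiE_def)
  have nn: "0 \<le> f z" if "z \<in> extensional I" for z
    using mtp ext[OF that] unfolding MTP2_on_def by blast
  define B where "B r = {x \<in> extensional I. \<forall>j\<in>J. x j \<le> r}" for r :: real
  have "finite J" using assms(2,4) finite_subset by auto
  have "{x \<in> space (Pi\<^sub>M I (\<lambda>_. borel)). \<forall>j\<in>J. x j \<le> r} \<in> sets (Pi\<^sub>M I (\<lambda>_. borel))" for r :: real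
  proof -
    have [measurable]: "(\<lambda>x. x j) \<in> borel_measurable (Pi\<^sub>M I (\<lambda>_. borel))" if "j \<in> J" for j
      using that assms(4) by (intro measurable_component_singleton) auto
    show ?thesis
      using \<open>finite J\<close> by measurable
  qed
  then have B: "B r \<in> sets (Pi\<^sub>M I N)" for r
    unfolding sets_N B_def by (simp add: space_PiM PiE_def)
  have U': "U \<in> sets (Pi\<^sub>M I N)" using U sets_N by simp
  have emb: "emeasure M {\<omega> \<in> space M. (\<lambda>i\<in>I. P i \<omega>) \<in> A}
      = (\<integral>\<^sup>+x. ennreal (f x) * indicator A x \<partial>Pi\<^sub>M I N)" if "A \<in> sets (Pi\<^sub>M I N)" for A
    using distributed_emeasure[OF D that] by (simp add: vimage_def Int_def conj_commute)
  have evB: "{\<omega> \<in> space M. (\<lambda>i\<in>I. P i \<omega>) \<in> B r} = {\<omega> \<in> space M. \<forall>j\<in>J. P j \<omega> \<le> r}" for r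
    using assms(4) by (auto simp: B_def subset_iff)
  have evUB: "{\<omega> \<in> space M. (\<lambda>i\<in>I. P i \<omega>) \<in> U \<inter> B r}
      = {\<omega> \<in> space M. (\<lambda>i\<in>I. P i \<omega>) \<in> U \<and> (\<forall>j\<in>J. P j \<omega> \<le> r)}" for r
    using assms(4) by (auto simp: B_def subset_iff)
  note [measurable] = distributed_borel_measurable[OF D] U' B
  have "(\<integral>\<^sup>+x. ennreal (f x) * indicator (U \<inter> B s) x \<partial>Pi\<^sub>M I N)
      * (\<integral>\<^sup>+x. ennreal (f x) * indicator (B t) x \<partial>Pi\<^sub>M I N)
    \<le> (\<integral>\<^sup>+x. ennreal (f x) * indicator (U \<inter> B t) x \<partial>Pi\<^sub>M I N)
      * (\<integral>\<^sup>+x. ennreal (f x) * indicator (B s) x \<partial>Pi\<^sub>M I N)"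
  proof (rule four_functions_PiM[OF N \<open>finite I\<close>])
    fix x y assume "x \<in> space (Pi\<^sub>M I N)" "y \<in> space (Pi\<^sub>M I N)"
    then have xy: "x \<in> extensional I" "y \<in> extensional I"
      by (auto simp: space_N)
    let ?j = "\<lambda>i\<in>I. max (x i) (y i)" and ?m = "\<lambda>i\<in>I. min (x i) (y i)"
    show "ennreal (f x) * indicator (U \<inter> B s) x * (ennreal (f y) * indicator (B t) y)
      \<le> ennreal (f ?j) * indicator (U \<inter> B t) ?j * (ennreal (f ?m) * indicator (B s) ?m)"
    proof (cases "x \<in> U \<inter> B s \<and> y \<in> B t")
      case True
      have "?j \<in> U"
        by (rule up[of x]) (use True in auto)
      moreover have "?j \<in> B t" "?m \<in> B s"
        using True assms(4,5)
        by (auto simp: B_def subset_iff intro: order_trans min.coboundedI1)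
      moreover have "f x * f y \<le> f ?j * f ?m"
        using mtp ext[OF xy(1)] ext[OF xy(2)] unfolding MTP2_on_def by blast
      moreover have "0 \<le> f x" "0 \<le> f y" "0 \<le> f ?j" "0 \<le> f ?m"
        using xy by (auto intro!: nn)
      ultimately show ?thesis
        using True by (simp add: ennreal_mult[symmetric] ennreal_leI)
    next
      case False
      then show ?thesis by (auto simp: indicator_def)
    qed
  qed measurable
  then show ?thesis
    unfolding emb[OF B, symmetric] emb[OF sets.Int[OF U' B], symmetric] evB evUB
    by (simp add: emeasure_eq_measure ennreal_mult[symmetric])
qed

section \<open>Order statistics as counts\<close>

text \<open>In a sorted list the positions of the entries at most t form an initial segment, which
  is determined by its length.\<close>

lemma sorted_nth_le_iff_length_filter:
  fixes xs :: "'b::linorder list"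
  assumes "sorted xs" "i < length xs"
  shows "xs ! i \<le> t \<longleftrightarrow> i < length (filter (\<lambda>x. x \<le> t) xs)"
proof -
  have card: "length (filter (\<lambda>x. x \<le> t) xs) = card {j. j < length xs \<and> xs ! j \<le> t}"
    by (rule length_filter_conv_card)
  show ?thesis
  proof
    assume "xs ! i \<le> t"
    then have "{..i} \<subseteq> {j. j < length xs \<and> xs ! j \<le> t}"
      using assms(2) sorted_nth_mono[OF assms(1) _ assms(2)] by (auto intro: order_trans)
    from card_mono[OF _ this] show "i < length (filter (\<lambda>x. x \<le> t) xs)"
      unfolding card by simp
  next
    assume less: "i < length (filter (\<lambda>x. x \<le> t) xs)"
    show "xs ! i \<le> t"
    proof (rule ccontr)
      assume "\<not> xs ! i \<le> t"
      then have "\<not> i \<le> j" if "j < length xs" "xs ! j \<le> t" for j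
        using sorted_nth_mono[OF assms(1), of i j] that by auto
      then have "{j. j < length xs \<and> xs ! j \<le> t} \<subseteq> {..<i}"
        by (auto simp: not_le)
      from card_mono[OF _ this] show False
        using less unfolding card by simp
    qed
  qed
qed

text \<open>Removes the sorting: in the counting form both the measurability of the event and its
  monotonicity in x are visible.\<close>

lemma order_stat_le_iff:
  assumes "i \<in> {1..n}"
  shows "order_stat n x i \<le> t \<longleftrightarrow> i \<le> card {j \<in> {1..n}. x j \<le> t}"
proof -
  have "length (filter (\<lambda>y. y \<le> t) (sort (map x [1..<Suc n]))) = length (filter (\<lambda>j. x j \<le> t) [1..<Suc n])"
    by (simp add: filter_sort filter_map comp_def del: upt_Suc)
  also have "\<dots> = card {j \<in> {1..n}. x j \<le> t}"
    by (subst distinct_length_filter) (auto intro!: arg_cong[where f = card] simp del: upt_Suc)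
  \<comment> \<open>List positions start at 0 and order statistics at 1: position i - 1 lies below
    the count exactly when i is at most the count, as i \<ge> 1.\<close>
  finally show ?thesis
    using assms unfolding order_stat_def
    by (subst sorted_nth_le_iff_length_filter) auto
qed

lemma sets_card_le:
  fixes X :: "nat \<Rightarrow> 'a \<Rightarrow> real"
  assumes "\<And>j. j \<in> I \<Longrightarrow> X j \<in> borel_measurable M"
  shows "{\<omega> \<in> space M. i \<le> card {j \<in> I. X j \<omega> \<le> t}} \<in> sets M"
proof -
  \<comment> \<open>\<open>measurable_card\<close> asks for this at every natural number j; outside
    I the event is empty.\<close>
  have "{\<omega> \<in> space M. j \<in> {j \<in> I. X j \<omega> \<le> t}} \<in> sets M" for j
  proof (cases "j \<in> I")
    case True
    note [measurable] = assms[OF True]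
    show ?thesis using True by simp
  qed simp
  note [measurable] = measurable_card[OF this]
  show ?thesis by measurable
qed

section \<open>Telescoping over the steps, and counting subsets of size k\<close>

text \<open>
  For \<open>E i\<close> the event of rejection at the \<open>i\<close>-th step, \<open>U i\<close> is the event \<open>R \<le> i\<close>, and
  \<open>E i \<inter> U i\<close> is the event \<open>R = i\<close>.
\<close>

lemma (in finite_measure) stepup_telescope:
  fixes c :: "nat \<Rightarrow> real" and E B :: "nat \<Rightarrow> 'a set" and k m n :: nat
  defines "U \<equiv> \<lambda>i. space M - (\<Union>j\<in>{i<..n}. E j)"
  assumes "k \<le> m" "m \<le> n"
    and sets: "\<And>i. i \<in> {k..n} \<Longrightarrow> E i \<in> sets M" "\<And>i. i \<in> {k..n} \<Longrightarrow> B i \<in> sets M"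
    and c: "\<And>i. i \<in> {k..n} \<Longrightarrow> 0 \<le> c i"
    and mono: "mono_on {k..n} (\<lambda>i. c i * measure M (B i))"
    and subset: "\<And>i. i \<in> {k..<n} \<Longrightarrow> B i \<subseteq> B (Suc i)"
    and cond: "\<And>i. i \<in> {k..<n} \<Longrightarrow>
      measure M (U i \<inter> B i) * measure M (B (Suc i)) \<le> measure M (U i \<inter> B (Suc i)) * measure M (B i)"
  shows "(\<Sum>i=k..m. c i * measure M (E i \<inter> U i \<inter> B i)) \<le> c m * measure M (U m \<inter> B m)"
proof -
  have U: "U i \<in> sets M" if "k \<le> i" for i
    using that unfolding U_def by (intro sets.Diff sets.finite_UN sets.top) (auto intro: sets(1))
  show ?thesis
    using \<open>k \<le> m\<close> \<open>m \<le> n\<close>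
  proof (induction m rule: dec_induct)
    case base
    then have "measure M (E k \<inter> U k \<inter> B k) \<le> measure M (U k \<inter> B k)"
      using U sets by (intro finite_measure_mono) auto
    then show ?case
      using base c by (simp add: mult_left_mono)
  next
    case (step m)
    let ?p = "measure M (B m)" and ?q = "measure M (B (Suc m))"
    have m: "m \<in> {k..<n}" "m \<in> {k..n}" "Suc m \<in> {k..n}"
      using step by auto
    \<comment> \<open>In conditional terms the left side is \<open>c m\<close>
      Pr(\<open>B m\<close>) Pr(\<open>U m\<close> | \<open>B m\<close>). Passing from m to
      \<open>Suc m\<close>, the factor \<open>c m\<close> Pr(\<open>B m\<close>) grows by
      \<open>mono\<close> and the conditional probability grows by \<open>cond\<close>.\<close>
    have "c m * measure M (U m \<inter> B m) \<le> c (Suc m) * measure M (U m \<inter> B (Suc m))"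
    proof (cases "?q = 0")
      \<comment> \<open>Conditioning on a null event is excluded; here the inclusion of
        \<open>B m\<close> in \<open>B (Suc m)\<close> makes the left side vanish.\<close>
      case True
      have "measure M (U m \<inter> B m) \<le> ?q"
        using subset[OF m(1)] sets m by (intro finite_measure_mono) auto
      then have "measure M (U m \<inter> B m) = 0"
        using True by (simp add: measure_le_0_iff)
      then show ?thesis
        using c[OF m(3)] by simp
    next
      case False
      then have q: "0 < ?q" by (simp add: zero_less_measure_iff)
      have "c m * (measure M (U m \<inter> B m) * ?q) \<le> c m * (measure M (U m \<inter> B (Suc m)) * ?p)"
        using cond[OF m(1)] c[OF m(2)] by (rule mult_left_mono)
      also have "\<dots> = measure M (U m \<inter> B (Suc m)) * (c m * ?p)"
        by simp
      also have "\<dots> \<le> measure M (U m \<inter> B (Suc m)) * (c (Suc m) * ?q)"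
        using mono_onD[OF mono m(2,3)] by (intro mult_left_mono) auto
      finally have "c m * measure M (U m \<inter> B m) * ?q \<le> c (Suc m) * measure M (U m \<inter> B (Suc m)) * ?q"
        by (simp add: ac_simps)
      with q show ?thesis by simp
    qed
    \<comment> \<open>Within \<open>B (Suc m)\<close>, the events R \<le> m and R = m + 1 are
      disjoint and both contained in R \<le> m + 1; this absorbs the new summand.\<close>
    moreover have "measure M (U m \<inter> B (Suc m)) + measure M (E (Suc m) \<inter> U (Suc m) \<inter> B (Suc m))
        \<le> measure M (U (Suc m) \<inter> B (Suc m))"
    proof (subst finite_measure_Union[symmetric])
      show "measure M (U m \<inter> B (Suc m) \<union> E (Suc m) \<inter> U (Suc m) \<inter> B (Suc m))
          \<le> measure M (U (Suc m) \<inter> B (Suc m))"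
        using U sets m by (intro finite_measure_mono) (auto simp: U_def)
      show "U m \<inter> B (Suc m) \<in> sets M" "E (Suc m) \<inter> U (Suc m) \<inter> B (Suc m) \<in> sets M"
        using U sets m by auto
      show "U m \<inter> B (Suc m) \<inter> (E (Suc m) \<inter> U (Suc m) \<inter> B (Suc m)) = {}"
        using m by (auto simp: U_def)
    qed
    then have "c (Suc m) * measure M (U m \<inter> B (Suc m))
        + c (Suc m) * measure M (E (Suc m) \<inter> U (Suc m) \<inter> B (Suc m))
        \<le> c (Suc m) * measure M (U (Suc m) \<inter> B (Suc m))"
      using c[OF m(3)] by (simp add: distrib_left[symmetric] mult_left_mono)
    ultimately show ?case
      using step by simp
  qed
qed

text \<open>Double counting: at a point of D, every k-subset of the at least i indices j with
  \<open>X j \<omega> \<le> t\<close> is a J whose event occurs, so at least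
  \<open>i choose k\<close> of the indicators equal 1. Integrating gives the bound.\<close>

lemma (in prob_space) binomial_mult_prob_le_sum:
  fixes X :: "nat \<Rightarrow> 'a \<Rightarrow> real"
  assumes "finite I" "\<And>j. j \<in> I \<Longrightarrow> X j \<in> borel_measurable M" "D \<in> sets M"
    and ge: "\<And>\<omega>. \<omega> \<in> D \<Longrightarrow> i \<le> card {j \<in> I. X j \<omega> \<le> t}"
  shows "real (i choose k) * prob D
    \<le> (\<Sum>J | J \<subseteq> I \<and> card J = k. prob (D \<inter> {\<omega> \<in> space M. \<forall>j\<in>J. X j \<omega> \<le> t}))"
proof -
  let ?C = "{J. J \<subseteq> I \<and> card J = k}" and ?B = "\<lambda>J. {\<omega> \<in> space M. \<forall>j\<in>J. X j \<omega> \<le> t}"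
  have "finite ?C"
    using \<open>finite I\<close> by simp
  have B: "?B J \<in> sets M" if "J \<in> ?C" for J
  proof -
    have [measurable]: "X j \<in> borel_measurable M" if "j \<in> J" for j
      using that \<open>J \<in> ?C\<close> assms(2) by auto
    have "finite J" using \<open>J \<in> ?C\<close> \<open>finite I\<close> finite_subset by auto
    then show ?thesis by measurable
  qed
  have "real (i choose k) * prob D = (\<integral>\<omega>. real (i choose k) * indicator D \<omega> \<partial>M)"
    using assms(3) by simp
  also have "\<dots> \<le> (\<integral>\<omega>. (\<Sum>J\<in>?C. indicator (D \<inter> ?B J) \<omega>) \<partial>M)"
  proof (rule integral_mono)
    fix \<omega> assume \<omega>: "\<omega> \<in> space M"
    show "real (i choose k) * indicator D \<omega> \<le> (\<Sum>J\<in>?C. indicator (D \<inter> ?B J) \<omega>)"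
    proof (cases "\<omega> \<in> D")
      case True
      let ?S = "{j \<in> I. X j \<omega> \<le> t}"
      have "i choose k \<le> card ?S choose k"
        using ge[OF True] by (rule binomial_right_mono)
      also have "\<dots> = card {J. J \<subseteq> ?S \<and> card J = k}"
        using \<open>finite I\<close> by (simp add: n_subsets)
      also have "{J. J \<subseteq> ?S \<and> card J = k} = {J \<in> ?C. \<omega> \<in> D \<inter> ?B J}"
        using True \<omega> by auto
      finally show ?thesis
        using True \<open>finite ?C\<close> by (simp add: indicator_def sum.If_cases Int_def)
    qed (simp add: sum_nonneg)
  qed (use assms(3) B in \<open>auto intro!: integrable_sum simp: integrable_indicator_iff less_top[symmetric]\<close>)
  also have "\<dots> = (\<Sum>J\<in>?C. prob (D \<inter> ?B J))"
    using assms(3) B by (subst Bochner_Integration.integral_sum) (auto simp: less_top[symmetric])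
  finally show ?thesis .
qed

section \<open>Decomposition by the last rejecting step, and summation over J\<close>

theorem theorem3p1:
  fixes M :: "'a measure" and P :: "nat \<Rightarrow> 'a \<Rightarrow> real"
    and \<alpha> a :: "nat \<Rightarrow> real" and n k :: nat
    and C :: "nat set set"
  assumes "prob_space M"
    and "1 \<le> n" and "1 \<le> k" and "k \<le> n"
    and "\<And>i \<omega>. i \<in> {1..n} \<Longrightarrow> \<omega> \<in> space M \<Longrightarrow> P i \<omega> \<in> {0..1}"
    and "MTP2_vector M {1..n} P"
    and "0 < \<alpha> k" and "mono_on {k..n} \<alpha>" and "\<alpha> n < 1"
    and "\<And>i. i \<in> {k..n} \<Longrightarrow> a i = real (i choose k)"
    and "C = {J. J \<subseteq> {1..n} \<and> card J = k}"
    and "\<And>J. J \<in> C \<Longrightarrow>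
           mono_on {k..n}
             (\<lambda>i. inverse (a i) * measure M {\<omega> \<in> space M. (MAX j\<in>J. P j \<omega>) \<le> \<alpha> i})"
  shows "measure M (\<Union>i\<in>{k..n}. {\<omega> \<in> space M. order_stat n (\<lambda>j. P j \<omega>) i \<le> \<alpha> i})
         \<le> inverse (a n) *
            (\<Sum>J\<in>C. measure M {\<omega> \<in> space M. (MAX j\<in>J. P j \<omega>) \<le> \<alpha> n})"
proof -
  interpret prob_space M by fact
  define E where "E i = {\<omega> \<in> space M. i \<le> card {j \<in> {1..n}. P j \<omega> \<le> \<alpha> i}}" for i
  define U where "U i = space M - (\<Union>j\<in>{i<..n}. E j)" for i
  define B where "B J i = {\<omega> \<in> space M. \<forall>j\<in>J. P j \<omega> \<le> \<alpha> i}" for J i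
  \<comment> \<open>Measurability is extracted from the density: \<open>distributed\<close> makes
    the whole vector measurable, and each \<open>\<nu> j\<close> carries the Borel sets.\<close>
  have P: "P j \<in> borel_measurable M" if "j \<in> {1..n}" for j
  proof -
    obtain \<nu> f where \<nu>: "\<And>i. i \<in> {1..n} \<Longrightarrow> sets (\<nu> i) = sets borel"
      and "distributed M (Pi\<^sub>M {1..n} \<nu>) (\<lambda>\<omega>. \<lambda>i\<in>{1..n}. P i \<omega>) (\<lambda>x. ennreal (f x))"
      using assms(6) unfolding MTP2_vector_def by blast
    then have "(\<lambda>\<omega>. \<lambda>i\<in>{1..n}. P i \<omega>) \<in> measurable M (Pi\<^sub>M {1..n} \<nu>)"
      using distributed_measurable by blast
    from measurable_compose[OF this measurable_component_singleton[OF that]] that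
    show ?thesis
      using measurable_cong_sets[OF refl \<nu>[OF that], of M] by simp
  qed
  \<comment> \<open>k \<ge> 1 makes J nonempty, so that \<open>MAX\<close> over J is a genuine
    maximum and its event is \<open>B J i\<close>.\<close>
  have C: "J \<subseteq> {1..n}" "finite J" "J \<noteq> {}" if "J \<in> C" for J
    using that \<open>1 \<le> k\<close> finite_subset[of J "{1..n}"] by (auto simp: assms(11))
  have max: "{\<omega> \<in> space M. (MAX j\<in>J. P j \<omega>) \<le> \<alpha> i} = B J i" if "J \<in> C" for J i
    using C[OF that] by (simp add: B_def)
  have E: "E i \<in> sets M" for i
    unfolding E_def using P by (rule sets_card_le)
  have U: "U i \<in> sets M" for i
    unfolding U_def using E by (intro sets.Diff sets.finite_UN) auto
  have B: "B J i \<in> sets M" if "J \<in> C" for J i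
  proof -
    have [measurable]: "P j \<in> borel_measurable M" if "j \<in> J" for j
      using that C(1)[OF \<open>J \<in> C\<close>] P by auto
    show ?thesis
      unfolding B_def using C(2)[OF that] by measurable
  qed
  have a: "0 < a i" if "i \<in> {k..n}" for i
    using that by (simp add: assms(10))

  have cond: "prob (U i \<inter> B J i) * prob (B J (Suc i)) \<le> prob (U i \<inter> B J (Suc i)) * prob (B J i)"
    if "J \<in> C" "i \<in> {k..<n}" for J i
  proof -
    \<comment> \<open>\<open>U i\<close> is the preimage of V under the vector of p-values. Raising
      coordinates lowers every count, so V is upward closed and conditional monotonicity applies to
      it.\<close>
    define V where "V = {x \<in> extensional {1..n}. \<forall>j\<in>{i<..n}. \<not> j \<le> card {l \<in> {1..n}. x l \<le> \<alpha> j}}"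
    have "{x \<in> space (Pi\<^sub>M {1..n} (\<lambda>_. borel)). j \<le> card {l \<in> {1..n}. x l \<le> \<alpha> j}}
        \<in> sets (Pi\<^sub>M {1..n} (\<lambda>_. borel))" for j
      by (rule sets_card_le) (rule measurable_component_singleton)
    then have "space (Pi\<^sub>M {1..n} (\<lambda>_. borel)) - (\<Union>j\<in>{i<..n}.
        {x \<in> space (Pi\<^sub>M {1..n} (\<lambda>_. borel)). j \<le> card {l \<in> {1..n}. x l \<le> \<alpha> j}})
        \<in> sets (Pi\<^sub>M {1..n} (\<lambda>_. borel))"
      by (intro sets.Diff sets.finite_UN) auto
    also have "space (Pi\<^sub>M {1..n} (\<lambda>_. borel)) - (\<Union>j\<in>{i<..n}.
        {x \<in> space (Pi\<^sub>M {1..n} (\<lambda>_. borel)). j \<le> card {l \<in> {1..n}. x l \<le> \<alpha> j}}) = V"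
      by (auto simp: V_def space_PiM PiE_def)
    finally have V: "V \<in> sets (Pi\<^sub>M {1..n} (\<lambda>_. borel))" .
    have up: "y \<in> V"
      if "x \<in> V" "y \<in> extensional {1..n}" and le: "\<And>l. l \<in> {1..n} \<Longrightarrow> x l \<le> y l" for x y
    proof -
      have "card {l \<in> {1..n}. y l \<le> \<alpha> j} \<le> card {l \<in> {1..n}. x l \<le> \<alpha> j}" for j
        using le by (intro card_mono) (auto intro: order_trans)
      with that(1,2) show ?thesis
        unfolding V_def using le_trans by blast
    qed
    have "card {l \<in> {1..n}. (\<lambda>i\<in>{1..n}. P i \<omega>) l \<le> \<alpha> j} = card {l \<in> {1..n}. P l \<omega> \<le> \<alpha> j}" for \<omega> j
      by (rule arg_cong[where f = card]) auto
    then have UV: "{\<omega> \<in> space M. (\<lambda>i\<in>{1..n}. P i \<omega>) \<in> V \<and> (\<forall>j\<in>J. P j \<omega> \<le> t)}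
        = U i \<inter> {\<omega> \<in> space M. \<forall>j\<in>J. P j \<omega> \<le> t}" for t
      by (auto simp: V_def U_def E_def)
    have "\<alpha> i \<le> \<alpha> (Suc i)"
      using mono_onD[OF assms(8)] that(2) by auto
    from MTP2_vector_orthant_mono[OF \<open>prob_space M\<close> _ assms(6) C(1)[OF that(1)] this V up]
    show ?thesis
      unfolding UV B_def by simp
  qed

  have "(\<Union>i\<in>{k..n}. {\<omega> \<in> space M. order_stat n (\<lambda>j. P j \<omega>) i \<le> \<alpha> i}) = (\<Union>i\<in>{k..n}. E i)"
    using \<open>1 \<le> k\<close> by (intro SUP_cong refl) (simp add: E_def order_stat_le_iff)
  \<comment> \<open>Each point of the union is assigned to the largest r with \<omega> in
    \<open>E r\<close>; no later step rejects there, which is membership in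
    \<open>U r\<close>.\<close>
  also have "(\<Union>i\<in>{k..n}. E i) \<subseteq> (\<Union>i\<in>{k..n}. E i \<inter> U i)"
  proof
    fix \<omega> assume "\<omega> \<in> (\<Union>i\<in>{k..n}. E i)"
    then have ne: "{i \<in> {k..n}. \<omega> \<in> E i} \<noteq> {}" by auto
    define r where "r = Max {i \<in> {k..n}. \<omega> \<in> E i}"
    have r: "r \<in> {k..n}" "\<omega> \<in> E r"
      using Max_in[OF _ ne] by (auto simp: r_def)
    moreover have "\<omega> \<notin> E j" if "j \<in> {r<..n}" for j
    proof
      assume "\<omega> \<in> E j"
      with that r(1) have "j \<le> r"
        unfolding r_def by (intro Max_ge) auto
      with that show False by simp
    qed
    ultimately have "\<omega> \<in> E r \<inter> U r"
      using sets.sets_into_space[OF E] by (auto simp: U_def)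
    with r(1) show "\<omega> \<in> (\<Union>i\<in>{k..n}. E i \<inter> U i)" by blast
  qed
  finally have "prob (\<Union>i\<in>{k..n}. {\<omega> \<in> space M. order_stat n (\<lambda>j. P j \<omega>) i \<le> \<alpha> i})
      \<le> prob (\<Union>i\<in>{k..n}. E i \<inter> U i)"
    using E U by (intro finite_measure_mono) auto
  also have "\<dots> \<le> (\<Sum>i=k..n. prob (E i \<inter> U i))"
    using E U by (intro finite_measure_subadditive_finite) auto
  also have "\<dots> \<le> (\<Sum>i=k..n. inverse (a i) * (\<Sum>J\<in>C. prob (E i \<inter> U i \<inter> B J i)))"
  proof (rule sum_mono)
    fix i assume i: "i \<in> {k..n}"
    have "a i * prob (E i \<inter> U i) \<le> (\<Sum>J\<in>C. prob (E i \<inter> U i \<inter> B J i))"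
      unfolding assms(10)[OF i] assms(11) B_def using E U P
      by (intro binomial_mult_prob_le_sum) (auto simp: E_def)
    then show "prob (E i \<inter> U i) \<le> inverse (a i) * (\<Sum>J\<in>C. prob (E i \<inter> U i \<inter> B J i))"
      using a[OF i] by (simp add: field_simps)
  qed
  \<comment> \<open>With J outermost, each inner sum concerns a single J, which is where the assumed
    monotonicity in i and \<open>cond\<close> can be used.\<close>
  also have "\<dots> = (\<Sum>J\<in>C. \<Sum>i=k..n. inverse (a i) * prob (E i \<inter> U i \<inter> B J i))"
    unfolding sum_distrib_left by (rule sum.swap)
  also have "\<dots> \<le> (\<Sum>J\<in>C. inverse (a n) * prob (B J n))"
  proof (rule sum_mono)
    fix J assume J: "J \<in> C"
    \<comment> \<open>The telescope is run to its end m = n with weights 1 / \<open>a i\<close>. No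
      step follows n, so \<open>U n\<close> is the whole space and the next bound loses
      nothing.\<close>
    have "(\<Sum>i=k..n. inverse (a i) * prob (E i \<inter> U i \<inter> B J i)) \<le> inverse (a n) * prob (U n \<inter> B J n)"
      unfolding U_def
    proof (rule stepup_telescope)
      show "mono_on {k..n} (\<lambda>i. inverse (a i) * prob (B J i))"
        using assms(12)[OF J] unfolding max[OF J] .
      show "B J i \<subseteq> B J (Suc i)" if "i \<in> {k..<n}" for i
        using mono_onD[OF assms(8), of i "Suc i"] that by (force simp: B_def)
    qed (use \<open>k \<le> n\<close> E B[OF J] a cond[OF J] in \<open>auto simp: U_def less_imp_le\<close>)
    also have "\<dots> \<le> inverse (a n) * prob (B J n)"
      using a[of n] \<open>k \<le> n\<close> B[OF J] by (intro mult_left_mono finite_measure_mono) auto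
    finally show "(\<Sum>i=k..n. inverse (a i) * prob (E i \<inter> U i \<inter> B J i)) \<le> inverse (a n) * prob (B J n)" .
  qed
  also have "\<dots> = inverse (a n) * (\<Sum>J\<in>C. prob {\<omega> \<in> space M. (MAX j\<in>J. P j \<omega>) \<le> \<alpha> n})"
    by (simp add: sum_distrib_left max)
  finally show ?thesis .
qed

end
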